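(* The union $\bigcup_{n\ge 0}S_{n,2}$ is not closed under taking classical permutation patterns. Consequently, it is not a classical permutation class.
   Context: $S_n$ is the set of permutations of $\{0,1,\ldots,n-1\}$, written as sequences of length $n$. $I_n$ is the set of inversion sequences of length $n$, i.e. integer sequences $\sigma=(\sigma_1,\ldots,\sigma_n)$ with $0\le\sigma_i<i$ for every $1\le i\le n$. For a finite integer sequence $\sigma$ of length $n$, $\Theta(\sigma)$ is the sequence of length $n$ defined by $\Theta(\sigma)_i=\#\{j<i:\sigma_j<\sigma_i\}$. $FP_n=\{\sigma\in I_n:\Theta(\sigma)=\sigma\}$ and $S_{n,2}=\{\sigma\in S_n:\Theta(\Theta(\sigma))\in FP_n\}$. A permutation $\rho\in S_m$ is a classical pattern of (is contained in) $\pi\in S_n$ if there are indices $i_1<\cdots<i_m$ such that $(\pi_{i_1},\ldots,\pi_{i_m})$ is order-isomorphic to $\rho$. A set of permutations is closed under taking classical patterns if it contains every classical pattern of each of its elements; a classical permutation class is a set of permutations closed under taking classical patterns. *)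

theory Defs
  imports Complex_Main "HOL-Combinatorics.Multiset_Permutations"
begin

text \<open>
  Finite integer sequences are lists, whose positions are counted from \<open>0\<close>: the entry
  \<open>\<sigma>\<^sub>i\<close> with \<open>1 \<le> i \<le> n\<close> is \<open>\<sigma> ! (i - 1)\<close>.
\<close>

definition perms :: "nat \<Rightarrow> int list set" where
  "perms n = permutations_of_set {0..<int n}"

text \<open>
  Counting positions from \<open>0\<close>, the condition \<open>0 \<le> \<sigma>\<^sub>i < i\<close> becomes
  \<open>0 \<le> \<sigma> ! i < i + 1\<close>.
\<close>

definition inversion_seqs :: "nat \<Rightarrow> int list set" where
  "inversion_seqs n = {\<sigma>. length \<sigma> = n \<and> (\<forall>i<n. 0 \<le> \<sigma> ! i \<and> \<sigma> ! i < int i + 1)}"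

definition Theta :: "int list \<Rightarrow> int list" where
  "Theta \<sigma> = map (\<lambda>i. int (card {j. j < i \<and> \<sigma> ! j < \<sigma> ! i})) [0..<length \<sigma>]"

definition FP :: "nat \<Rightarrow> int list set" where
  "FP n = {\<sigma> \<in> inversion_seqs n. Theta \<sigma> = \<sigma>}"

definition perms2 :: "nat \<Rightarrow> int list set" where
  "perms2 n = {\<sigma> \<in> perms n. Theta (Theta \<sigma>) \<in> FP n}"

definition order_isomorphic :: "int list \<Rightarrow> int list \<Rightarrow> bool" where
  "order_isomorphic xs ys \<longleftrightarrow> length xs = length ys \<and>
     (\<forall>i<length xs. \<forall>j<length xs. xs ! i < xs ! j \<longleftrightarrow> ys ! i < ys ! j)"

definition pattern_of :: "int list \<Rightarrow> int list \<Rightarrow> bool" where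
  "pattern_of \<rho> \<pi> \<longleftrightarrow>
     (\<exists>is. sorted_wrt (<) is \<and> set is \<subseteq> {..<length \<pi>} \<and>
           order_isomorphic (map (\<lambda>i. \<pi> ! i) is) \<rho>)"

definition closed_under_patterns :: "int list set \<Rightarrow> bool" where
  "closed_under_patterns A \<longleftrightarrow>
     (\<forall>\<pi>\<in>A. \<forall>m. \<forall>\<rho>\<in>perms m. pattern_of \<rho> \<pi> \<longrightarrow> \<rho> \<in> A)"

definition permutation_class :: "int list set \<Rightarrow> bool" where
  "permutation_class A \<longleftrightarrow> A \<subseteq> (\<Union>n. perms n) \<and> closed_under_patterns A"

end

theory Submission
  imports Defs
begin

text \<open>
  The permutation \<open>[3,4,1,0,2]\<close> has \<open>\<Theta>\<close>-iterates \<open>[0,1,0,0,2]\<close> and \<open>[0,1,0,0,4]\<close>, the latter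
  fixed. Deleting the entry \<open>1\<close> leaves the pattern \<open>[2,3,0,1]\<close>, with iterates \<open>[0,1,0,1]\<close>,
  \<open>[0,1,0,2]\<close>, \<open>[0,1,0,3]\<close>, so that it takes three steps to reach a fixed point.
\<close>

text \<open>With the cardinality turned into the length of a filtered list, \<open>simp\<close> can
  evaluate \<open>Theta\<close> on concrete lists.\<close>

lemma Theta_filter:
  "Theta \<sigma> = map (\<lambda>i. int (length (filter (\<lambda>j. \<sigma> ! j < \<sigma> ! i) [0..<i]))) [0..<length \<sigma>]"
proof -
  have "card {j. j < i \<and> \<sigma> ! j < \<sigma> ! i} = length (filter (\<lambda>j. \<sigma> ! j < \<sigma> ! i) [0..<i])" for i
    by (subst distinct_card [symmetric]) (auto intro: arg_cong [where f = card])
  then show ?thesis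
    by (simp add: Theta_def)
qed

lemma Theta_Theta_34102: "Theta (Theta [3,4,1,0,2]) = [0,1,0,0,4]"
  by (simp add: Theta_filter eval_nat_numeral)

lemma perms2_34102: "[3,4,1,0,2] \<in> perms2 5"
proof -
  have "[3,4,1,0,2] \<in> perms 5"
    by (auto simp: perms_def permutations_of_set_def)
  moreover have "[0,1,0,0,4] \<in> inversion_seqs 5"
    by (simp add: inversion_seqs_def All_less_Suc eval_nat_numeral)
  moreover have "Theta [0,1,0,0,4] = [0,1,0,0,4]"
    by (simp add: Theta_filter eval_nat_numeral)
  ultimately show ?thesis
    by (simp add: perms2_def FP_def Theta_Theta_34102)
qed

lemma perms_2301: "[2,3,0,1] \<in> perms 4"
  by (auto simp: perms_def permutations_of_set_def)

lemma pattern_of_2301_34102: "pattern_of [2,3,0,1] [3,4,1,0,2]"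
  unfolding pattern_of_def
  \<comment> \<open>All positions except 2, where the entry 1 stands; the entries left are 3, 4, 0,
    2.\<close>
  by (rule exI [where x = "[0,1,3,4]"])
     (simp add: order_isomorphic_def All_less_Suc eval_nat_numeral)

text \<open>The fixed-point equation in \<open>FP\<close> already fails, and it does not depend on
  \<open>n\<close>; this excludes the whole union, not just \<open>perms2 4\<close>.\<close>

lemma not_perms2_2301: "[2,3,0,1] \<notin> perms2 n"
proof -
  have "Theta (Theta [2,3,0,1]) = [0,1,0,2]" "Theta [0,1,0,2] = [0,1,0,3]"
    by (simp_all add: Theta_filter eval_nat_numeral)
  then show ?thesis
    by (simp add: perms2_def FP_def)
qed

theorem proposition6p1:
  shows "\<not> closed_under_patterns (\<Union>n. perms2 n) \<and> \<not> permutation_class (\<Union>n. perms2 n)"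
proof -
  have "\<not> closed_under_patterns (\<Union>n. perms2 n)"
    using perms2_34102 perms_2301 pattern_of_2301_34102 not_perms2_2301
    unfolding closed_under_patterns_def by blast
  then show ?thesis
    by (simp add: permutation_class_def)
qed

end
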